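(* Let $(B_n,R_n,X_n)_{n\ge1}$ be a sequence of wagers, adapted to a filtration $(\mathcal{F}_n)_{n\ge0}$ (that is, $B_n$, $R_n$, $X_n$ are $\mathcal{F}_n$-measurable for each $n\ge1$). Suppose that $$\sup_{n\ge1}\mathbb{E}[B_n^2]<\infty,\qquad \liminf_{n\to\infty}\frac1n\sum_{k=1}^n B_k>0\quad\text{a.s.},$$ and $\sup_{n\ge1}\mathbb{E}[R_n^2]<\infty$ (or equivalently, $\sup_{n\ge1}\mathbb{E}[X_n^2]<\infty$). Put $$\mathfrak{R}_n:=\frac{\sum_{k=1}^n R_k}{\sum_{k=1}^n B_k},\qquad \mathfrak{X}_n:=\frac{\sum_{k=1}^n X_k}{\sum_{k=1}^n B_k}.$$ (a) Then, almost surely, $$\liminf_{n\to\infty}\frac{\sum_{k=1}^n \mathbb{E}[R_k\mid\mathcal{F}_{k-1}]}{\sum_{k=1}^n \mathbb{E}[B_k\mid\mathcal{F}_{k-1}]}=\liminf_{n\to\infty}\mathfrak{R}_n\le\limsup_{n\to\infty}\mathfrak{R}_n=\limsup_{n\to\infty}\frac{\sum_{k=1}^n \mathbb{E}[R_k\mid\mathcal{F}_{k-1}]}{\sum_{k=1}^n \mathbb{E}[B_k\mid\mathcal{F}_{k-1}]}$$ and $$\liminf_{n\to\infty}\frac{\sum_{k=1}^n \mathbb{E}[X_k\mid\mathcal{F}_{k-1}]}{\sum_{k=1}^n \mathbb{E}[B_k\mid\mathcal{F}_{k-1}]}=\liminf_{n\to\infty}\mathfrak{X}_n\le\limsup_{n\to\infty}\mathfrak{X}_n=\limsup_{n\to\infty}\frac{\sum_{k=1}^n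 \mathbb{E}[X_k\mid\mathcal{F}_{k-1}]}{\sum_{k=1}^n \mathbb{E}[B_k\mid\mathcal{F}_{k-1}]}.$$ (b) Moreover, if there exist constants $\rho',\rho''$ such that $$\rho'\le\frac{\mathbb{E}[R_n\mid\mathcal{F}_{n-1}]}{\mathbb{E}[B_n\mid\mathcal{F}_{n-1}]}\le\rho''\quad\text{a.s. for all } n\ge1,$$ or equivalently (with $\chi'=\rho'-1$ and $\chi''=\rho''-1$) constants $\chi',\chi''$ such that $$\chi'\le\frac{\mathbb{E}[X_n\mid\mathcal{F}_{n-1}]}{\mathbb{E}[B_n\mid\mathcal{F}_{n-1}]}\le\chi''\quad\text{a.s. for all } n\ge1,$$ then $$\rho'\le\liminf_{n\to\infty}\mathfrak{R}_n\le\limsup_{n\to\infty}\mathfrak{R}_n\le\rho''\quad\text{a.s.}\qquad\text{and}\qquad \chi'\le\liminf_{n\to\infty}\mathfrak{X}_n\le\limsup_{n\to\infty}\mathfrak{X}_n\le\chi''\quad\text{a.s.}$$ In particular, if $\rho'=\rho''=\rho$, or equivalently $\chi'=\chi''=\chi$, then $\lim_{n\to\infty}\mathfrak{R}_n=\rho$ a.s. and $\lim_{n\to\infty}\mathfrak{X}_n=\chi$ a.s.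
   Context: All random variables live on a common probability space. A wager is a triple $(B,R,X)$ of real random variables (bet, return, profit) with $B\ge0$, $R\ge0$, $X=R-B$, and $R=X=0$ whenever $B=0$. In the sequence, $B_n,R_n,X_n$ are the bet, return, and profit at the $n$th coup (play), and $\mathcal{F}_n$ is interpreted as the $\sigma$-algebra of events whose occurrence or nonoccurrence is known following the $n$th coup. The two-sided inequalities in (b) on ratios of conditional expectations are regarded as satisfied wherever the ratio is of the form $0/0$. The ratios $\mathfrak{R}_n$, $\mathfrak{X}_n$ and the ratios of sums of conditional expectations are considered for $n$ large enough that the denominator is positive (which holds eventually, almost surely). *)

theory Defs
  imports "HOL-Probability.Probability"
begin

definition wager :: "'a measure \<Rightarrow> ('a \<Rightarrow> real) \<Rightarrow> ('a \<Rightarrow> real) \<Rightarrow> ('a \<Rightarrow> real) \<Rightarrow> bool" where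
  "wager M B R X \<longleftrightarrow>
     B \<in> borel_measurable M \<and> R \<in> borel_measurable M \<and> X \<in> borel_measurable M \<and>
     (\<forall>\<omega>\<in>space M. B \<omega> \<ge> 0 \<and> R \<omega> \<ge> 0 \<and> X \<omega> = R \<omega> - B \<omega> \<and>
        (B \<omega> = 0 \<longrightarrow> R \<omega> = 0 \<and> X \<omega> = 0))"

(* Sequences of random variables are indexed by the coup number n >= 1; the value at index 0
   is never used.  The filtration is indexed from 0. *)

definition adapted_seq :: "(nat \<Rightarrow> 'a measure) \<Rightarrow> (nat \<Rightarrow> 'a \<Rightarrow> real) \<Rightarrow> bool" where
  "adapted_seq F Y \<longleftrightarrow> (\<forall>n\<ge>1. Y n \<in> borel_measurable (F n))"

(* The second moment is a Lebesgue integral with values in [0,\<infinity>], so finiteness of the supremum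
   entails square integrability rather than presupposing it. *)

definition L2_bounded :: "'a measure \<Rightarrow> (nat \<Rightarrow> 'a \<Rightarrow> real) \<Rightarrow> bool" where
  "L2_bounded M Y \<longleftrightarrow> (SUP n\<in>{1..}. \<integral>\<^sup>+ \<omega>. ennreal ((Y n \<omega>)\<^sup>2) \<partial>M) < \<infinity>"

definition pred_exp ::
  "'a measure \<Rightarrow> (nat \<Rightarrow> 'a measure) \<Rightarrow> (nat \<Rightarrow> 'a \<Rightarrow> real) \<Rightarrow> nat \<Rightarrow> 'a \<Rightarrow> real" where
  "pred_exp M F Y n = real_cond_exp M (F (n - 1)) (Y n)"

(* Has value 0 where the denominator vanishes; only large n matter below. *)

definition sum_ratio ::
  "(nat \<Rightarrow> 'a \<Rightarrow> real) \<Rightarrow> (nat \<Rightarrow> 'a \<Rightarrow> real) \<Rightarrow> nat \<Rightarrow> 'a \<Rightarrow> real" where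
  "sum_ratio Y B n \<omega> = (\<Sum>k=1..n. Y k \<omega>) / (\<Sum>k=1..n. B k \<omega>)"

(* l <= p/q <= u, regarded as satisfied for 0/0, and as violated for p/0 with p \<noteq> 0. *)

definition ratio_between :: "real \<Rightarrow> real \<Rightarrow> real \<Rightarrow> real \<Rightarrow> bool" where
  "ratio_between l p q u \<longleftrightarrow>
     (p = 0 \<and> q = 0) \<or> (q \<noteq> 0 \<and> l \<le> p / q \<and> p / q \<le> u)"

definition cond_ratio_between ::
  "'a measure \<Rightarrow> (nat \<Rightarrow> 'a measure) \<Rightarrow> (nat \<Rightarrow> 'a \<Rightarrow> real) \<Rightarrow> (nat \<Rightarrow> 'a \<Rightarrow> real) \<Rightarrow>
     real \<Rightarrow> real \<Rightarrow> bool" where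
  "cond_ratio_between M F Y B l u \<longleftrightarrow>
     (\<forall>n\<ge>1. AE \<omega> in M. ratio_between l (pred_exp M F Y n \<omega>) (pred_exp M F B n \<omega>) u)"

end

theory Submission
  imports Defs "HOL-Library.Discrete_Functions"
begin

text \<open>The differences \<open>Y\<^sub>k - E[Y\<^sub>k | F\<^sub>k\<^sub>-\<^sub>1]\<close> are orthogonal with bounded second moments, so their
  averages tend to 0 almost surely. As the averages of the bets stay away from 0, passing from the
  sums of \<open>Y\<^sub>k\<close> and \<open>B\<^sub>k\<close> to their predictable versions multiplies the ratio by a factor tending to 1
  after adding a term tending to 0. This preserves lower and upper limits even when they are
  infinite, which can happen, since nothing bounds the averages of the returns.\<close>

section \<open>Square-integrable functions\<close>

lemma integrable_mult_of_squares:
  fixes f g :: "'a \<Rightarrow> real"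
  assumes [measurable]: "f \<in> borel_measurable M" "g \<in> borel_measurable M"
    and "integrable M (\<lambda>x. (f x)\<^sup>2)" "integrable M (\<lambda>x. (g x)\<^sup>2)"
  shows "integrable M (\<lambda>x. f x * g x)"
proof (rule Bochner_Integration.integrable_bound)
  show "integrable M (\<lambda>x. (f x)\<^sup>2 + (g x)\<^sup>2)"
    using assms by simp
  have "\<bar>a * b\<bar> \<le> a\<^sup>2 + b\<^sup>2" for a b :: real
  proof -
    have "0 \<le> \<bar>a\<bar> * \<bar>b\<bar>"
      by simp
    then show ?thesis
      using sum_squares_bound[of "\<bar>a\<bar>" "\<bar>b\<bar>"] unfolding abs_mult power2_abs by linarith
  qed
  then show "AE x in M. norm (f x * g x) \<le> norm ((f x)\<^sup>2 + (g x)\<^sup>2)"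
    by (auto intro!: AE_I2)
qed measurable

lemma integrable_power2_add:
  fixes f g :: "'a \<Rightarrow> real"
  assumes "f \<in> borel_measurable M" "g \<in> borel_measurable M"
    and "integrable M (\<lambda>x. (f x)\<^sup>2)" "integrable M (\<lambda>x. (g x)\<^sup>2)"
  shows "integrable M (\<lambda>x. (f x + g x)\<^sup>2)"
  using assms integrable_mult_of_squares[OF assms] by (simp add: power2_sum mult.assoc)

lemma integrable_power2_sum:
  fixes f :: "'i \<Rightarrow> 'a \<Rightarrow> real"
  assumes "finite I" and "\<And>i. i \<in> I \<Longrightarrow> f i \<in> borel_measurable M"
    and "\<And>i. i \<in> I \<Longrightarrow> integrable M (\<lambda>x. (f i x)\<^sup>2)"
  shows "integrable M (\<lambda>x. (\<Sum>i\<in>I. f i x)\<^sup>2)"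
  using assms by (induction I rule: finite_induct) (auto intro!: integrable_power2_add)

section \<open>Strong law for orthogonal sequences\<close>

text \<open>Exchanging series and integral shows that the series of the \<open>f m\<close> has a
  finite integral, so it converges almost everywhere and its terms vanish. This takes the place of a
  Chebyshev and Borel-Cantelli argument.\<close>

lemma AE_tendsto_0_of_summable_integral:
  fixes f :: "nat \<Rightarrow> 'a \<Rightarrow> real"
  assumes int: "\<And>m. integrable M (f m)" and nonneg: "\<And>m x. 0 \<le> f m x"
    and "summable (\<lambda>m. \<integral>x. f m x \<partial>M)"
  shows "AE x in M. (\<lambda>m. f m x) \<longlonglongrightarrow> 0"
proof -
  have [measurable]: "f m \<in> borel_measurable M" for m
    using int by auto
  have "(\<integral>\<^sup>+ x. (\<Sum>m. ennreal (f m x)) \<partial>M) = (\<Sum>m. \<integral>\<^sup>+ x. ennreal (f m x) \<partial>M)"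
    by (rule nn_integral_suminf) simp
  also have "\<dots> = (\<Sum>m. ennreal (\<integral>x. f m x \<partial>M))"
    using int nonneg by (simp add: nn_integral_eq_integral)
  also have "\<dots> = ennreal (\<Sum>m. \<integral>x. f m x \<partial>M)"
    using assms by (intro suminf_ennreal2) auto
  finally have "(\<integral>\<^sup>+ x. (\<Sum>m. ennreal (f m x)) \<partial>M) \<noteq> \<infinity>"
    by simp
  then have "AE x in M. (\<Sum>m. ennreal (f m x)) \<noteq> \<infinity>"
    by (intro nn_integral_PInf_AE) auto
  then show ?thesis
    by eventually_elim (auto intro!: summable_LIMSEQ_zero summable_suminf_not_top nonneg)
qed

text \<open>Pythagoras: when the square of the sum is expanded, the mixed terms integrate to 0 and
  only the diagonal survives.\<close>

lemma integral_power2_sum_orthogonal_le: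
  fixes D :: "nat \<Rightarrow> 'a \<Rightarrow> real"
  assumes "finite I" and [measurable]: "\<And>i. i \<in> I \<Longrightarrow> D i \<in> borel_measurable M"
    and sq: "\<And>i. i \<in> I \<Longrightarrow> integrable M (\<lambda>x. (D i x)\<^sup>2)"
    and C: "\<And>i. i \<in> I \<Longrightarrow> (\<integral>x. (D i x)\<^sup>2 \<partial>M) \<le> C"
    and orth: "\<And>i j. i \<in> I \<Longrightarrow> j \<in> I \<Longrightarrow> i < j \<Longrightarrow> (\<integral>x. D i x * D j x \<partial>M) = 0"
  shows "(\<integral>x. (\<Sum>i\<in>I. D i x)\<^sup>2 \<partial>M) \<le> real (card I) * C"
proof -
  have prod: "integrable M (\<lambda>x. D i x * D j x)" if "i \<in> I" "j \<in> I" for i j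
    using that sq by (intro integrable_mult_of_squares) auto
  have zero: "(\<integral>x. D i x * D j x \<partial>M) = 0" if "i \<in> I" "j \<in> I" "i \<noteq> j" for i j
    using orth[of i j] orth[of j i] that by (cases i j rule: linorder_cases) (auto simp: mult.commute)
  have "(\<integral>x. (\<Sum>i\<in>I. D i x)\<^sup>2 \<partial>M) = (\<integral>x. (\<Sum>i\<in>I. \<Sum>j\<in>I. D i x * D j x) \<partial>M)"
    by (simp add: power2_eq_square sum_product)
  also have "\<dots> = (\<Sum>i\<in>I. \<Sum>j\<in>I. \<integral>x. D i x * D j x \<partial>M)"
    using prod by (simp add: integral_sum)
  also have "\<dots> = (\<Sum>i\<in>I. \<Sum>j\<in>I. if j = i then \<integral>x. (D i x)\<^sup>2 \<partial>M else 0)"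
    using zero by (intro sum.cong refl) (auto simp: power2_eq_square)
  also have "\<dots> = (\<Sum>i\<in>I. \<integral>x. (D i x)\<^sup>2 \<partial>M)"
    using \<open>finite I\<close> by simp
  also have "\<dots> \<le> real (card I) * C"
    using sum_mono[OF C] by simp
  finally show ?thesis .
qed

text \<open>Second moments are summable along the squares \<open>m\<^sup>2\<close>, and the gap between consecutive squares
  is short enough for the Cauchy--Schwarz inequality, so no maximal inequality is needed.\<close>

lemma orthogonal_strong_law:
  fixes D :: "nat \<Rightarrow> 'a \<Rightarrow> real"
  assumes meas: "\<And>k. k \<ge> 1 \<Longrightarrow> D k \<in> borel_measurable M"
    and sq: "\<And>k. k \<ge> 1 \<Longrightarrow> integrable M (\<lambda>x. (D k x)\<^sup>2)"
    and C: "\<And>k. k \<ge> 1 \<Longrightarrow> (\<integral>x. (D k x)\<^sup>2 \<partial>M) \<le> C"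
    and orth: "\<And>j k. 1 \<le> j \<Longrightarrow> j < k \<Longrightarrow> (\<integral>x. D j x * D k x \<partial>M) = 0"
  shows "AE x in M. (\<lambda>n. (\<Sum>k=1..n. D k x) / real n) \<longlonglongrightarrow> 0"
proof -
  define S where "S n x = (\<Sum>k=1..n. D k x)" for n x
  \<comment> \<open>The blocks between consecutive squares have \<open>2 * m + 1\<close> elements;
    \<open>T m\<close> bounds every partial sum of \<open>D\<close> that starts at the left end of
    block \<open>m\<close> and stays inside it.\<close>
  define J where "J m = {m\<^sup>2<..(Suc m)\<^sup>2}" for m :: nat
  define T where "T m x = (\<Sum>k\<in>J m. \<bar>D k x\<bar>)" for m x
  \<comment> \<open>Both summands have integrals of order 1/m^2, so a single summable series
    controls the sums at the squares and the fluctuation in between. Division by zero makes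
    \<open>f 0\<close> vanish.\<close>
  define f where "f m x = (S (m\<^sup>2) x / (real m)\<^sup>2)\<^sup>2 + (T m x / (real m)\<^sup>2)\<^sup>2" for m x
  \<comment> \<open>This is implicit in the bound at index 1; it lets \<open>2 * m + 1\<close> be
    replaced by \<open>3 * m\<close> in front of \<open>C\<close>.\<close>
  have "C \<ge> 0"
  proof -
    have "0 \<le> (\<integral>x. (D 1 x)\<^sup>2 \<partial>M)"
      by simp
    also have "\<dots> \<le> C"
      by (rule C) simp
    finally show ?thesis .
  qed
  have J1: "k \<ge> 1" if "k \<in> J m" for k m
    using that by (auto simp: J_def)
  have finJ: "finite (J m)" for m
    by (simp add: J_def)
  have cardJ: "card (J m) = 2 * m + 1" for m
    by (simp add: J_def power2_eq_square)
  have intS: "integrable M (\<lambda>x. (S n x)\<^sup>2)" for n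
    unfolding S_def using meas sq by (intro integrable_power2_sum) auto
  have intT: "integrable M (\<lambda>x. (T m x)\<^sup>2)" for m
    unfolding T_def using meas sq J1 finJ by (intro integrable_power2_sum) auto
  have ES: "(\<integral>x. (S n x)\<^sup>2 \<partial>M) \<le> real n * C" for n
    using integral_power2_sum_orthogonal_le[of "{1..n}" D M C] meas sq C orth by (auto simp: S_def)
  \<comment> \<open>Absolute values destroy orthogonality, so Cauchy-Schwarz over the block is used
    instead. It costs a factor \<open>card (J m)\<close>, which is affordable because the block has
    length of order m only.\<close>
  have ET: "(\<integral>x. (T m x)\<^sup>2 \<partial>M) \<le> (2 * real m + 1)\<^sup>2 * C" for m
  proof -
    have "(\<integral>x. (T m x)\<^sup>2 \<partial>M) \<le> (\<integral>x. (\<Sum>k\<in>J m. (D k x)\<^sup>2) * real (card (J m)) \<partial>M)"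
    proof (rule integral_mono)
      show "integrable M (\<lambda>x. (\<Sum>k\<in>J m. (D k x)\<^sup>2) * real (card (J m)))"
        using sq J1 by (intro integrable_mult_left Bochner_Integration.integrable_sum) auto
      show "(T m x)\<^sup>2 \<le> (\<Sum>k\<in>J m. (D k x)\<^sup>2) * real (card (J m))" for x
        using sum_squared_le_sum_of_squares[of "\<lambda>k. \<bar>D k x\<bar>" "J m"] by (simp add: T_def)
    qed (rule intT)
    also have "\<dots> = (\<Sum>k\<in>J m. \<integral>x. (D k x)\<^sup>2 \<partial>M) * real (card (J m))"
      using sq J1 by (simp add: integral_sum)
    also have "\<dots> \<le> (real (card (J m)) * C) * real (card (J m))"
      using sum_mono[of "J m" "\<lambda>k. \<integral>x. (D k x)\<^sup>2 \<partial>M" "\<lambda>_. C"] C J1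
      by (intro mult_right_mono) auto
    also have "\<dots> = (2 * real m + 1)\<^sup>2 * C"
      by (simp add: cardJ power2_eq_square algebra_simps)
    finally show ?thesis .
  qed
  have intf: "integrable M (f m)" for m
    unfolding f_def power_divide using intS intT by simp
  \<comment> \<open>The constant is 1 + 9: the sum up to m^2 contributes m^2 C, and the block at
    most (3 m)^2 C since 2 m + 1 \<le> 3 m for m \<ge> 1; both are divided by m^4.\<close>
  have Ef: "(\<integral>x. f m x \<partial>M) \<le> 10 * C * (1 / (real m)\<^sup>2)" for m
  proof (cases "m = 0")
    case False
    have "(\<integral>x. f m x \<partial>M) = ((\<integral>x. (S (m\<^sup>2) x)\<^sup>2 \<partial>M) + (\<integral>x. (T m x)\<^sup>2 \<partial>M)) / (real m)^4"
      unfolding f_def power_divide using intS intT by (simp add: add_divide_distrib)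
    also have "\<dots> \<le> ((real m)\<^sup>2 * C + (3 * real m)\<^sup>2 * C) / (real m)^4"
    proof (rule divide_right_mono, rule add_mono)
      have "(2 * real m + 1)\<^sup>2 * C \<le> (3 * real m)\<^sup>2 * C"
        using False \<open>C \<ge> 0\<close> by (intro mult_right_mono power_mono) auto
      then show "(\<integral>x. (T m x)\<^sup>2 \<partial>M) \<le> (3 * real m)\<^sup>2 * C"
        using ET[of m] by linarith
    qed (use ES[of "m\<^sup>2"] in auto)
    also have "\<dots> = 10 * C * (1 / (real m)\<^sup>2)"
      using False by (simp add: field_simps power2_eq_square power4_eq_xxxx)
    finally show ?thesis .
  qed (simp add: f_def)
  have "summable (\<lambda>m. 10 * C * (1 / (real m)\<^sup>2))"
    using inverse_power_summable[of 2, where 'a = real]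
    by (intro summable_mult) (simp add: inverse_eq_divide)
  then have "summable (\<lambda>m. \<integral>x. f m x \<partial>M)"
    by (rule summable_comparison_test_ev[rotated])
       (use Ef in \<open>auto simp: f_def intro!: always_eventually\<close>)
  then have "AE x in M. (\<lambda>m. f m x) \<longlonglongrightarrow> 0"
    by (intro AE_tendsto_0_of_summable_integral intf) (simp_all add: f_def)
  then show ?thesis
  proof eventually_elim
    fix x assume lim: "(\<lambda>m. f m x) \<longlonglongrightarrow> 0"
    \<comment> \<open>Each of the two quotients whose squares make up \<open>f m x\<close> is at
      most its square root, hence the factor 2.\<close>
    define g where "g m = 2 * sqrt (f m x)" for m
    have "g \<longlonglongrightarrow> 0"
      using tendsto_mult[OF tendsto_const tendsto_real_sqrt[OF lim], of 2] by (simp add: g_def[abs_def])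
    \<comment> \<open>Composing with \<open>floor_sqrt\<close> turns convergence in the block index
      into convergence in n.\<close>
    moreover have "filterlim floor_sqrt at_top sequentially"
      unfolding filterlim_at_top using le_floor_sqrt_iff
      by (metis eventually_sequentiallyI)
    ultimately have "(\<lambda>n. g (floor_sqrt n)) \<longlonglongrightarrow> 0"
      by (rule filterlim_compose)
    then show "(\<lambda>n. (\<Sum>k=1..n. D k x) / real n) \<longlonglongrightarrow> 0"
    proof (rule Lim_null_comparison[rotated], intro eventually_sequentiallyI[of 1])
      fix n :: nat assume n: "n \<ge> 1"
      \<comment> \<open>With m^2 \<le> n < (m+1)^2 the sum up to n differs from the sum up to m^2 by
        terms from block \<open>J m\<close> only, and replacing the divisor n by m^2 can only
        enlarge the quotient.\<close>
      define m where "m = floor_sqrt n"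
      have m: "m\<^sup>2 \<le> n" "n < (Suc m)\<^sup>2" "m > 0"
        using n Suc_floor_sqrt_power2_gt[of n] by (auto simp: m_def)
      have "{1..n} = {1..m\<^sup>2} \<union> {m\<^sup>2<..n}"
        using m by auto
      then have "S n x = S (m\<^sup>2) x + (\<Sum>k\<in>{m\<^sup>2<..n}. D k x)"
        unfolding S_def by (simp, subst sum.union_disjoint) auto
      moreover have "\<bar>\<Sum>k\<in>{m\<^sup>2<..n}. D k x\<bar> \<le> (\<Sum>k\<in>{m\<^sup>2<..n}. \<bar>D k x\<bar>)"
        by (rule sum_abs)
      moreover have "(\<Sum>k\<in>{m\<^sup>2<..n}. \<bar>D k x\<bar>) \<le> T m x"
        unfolding T_def J_def using m by (intro sum_mono2) auto
      ultimately have "\<bar>S n x\<bar> \<le> \<bar>S (m\<^sup>2) x\<bar> + T m x"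
        by linarith
      moreover have "T m x \<ge> 0"
        by (simp add: T_def sum_nonneg)
      ultimately have "\<bar>S n x\<bar> / real n \<le> (\<bar>S (m\<^sup>2) x\<bar> + T m x) / (real m)\<^sup>2"
        using m n of_nat_mono[OF m(1), where 'a = real] by (intro frac_le) auto
      also have "\<dots> \<le> g m"
      proof -
        have "\<bar>S (m\<^sup>2) x / (real m)\<^sup>2\<bar> \<le> sqrt (f m x)" "\<bar>T m x / (real m)\<^sup>2\<bar> \<le> sqrt (f m x)"
          by (rule real_le_rsqrt, simp only: f_def power2_abs, simp)+
        then show ?thesis
          using \<open>T m x \<ge> 0\<close> by (simp add: g_def add_divide_distrib)
      qed
      finally show "norm ((\<Sum>k=1..n. D k x) / real n) \<le> g (floor_sqrt n)"
        by (simp add: S_def m_def)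
    qed
  qed
qed

section \<open>Sequences bounded in L2\<close>

text \<open>Trades the extended-real supremum for one real constant. Integrability of the squares
  comes first, so that the Bochner integrals are genuine second moments.\<close>

lemma L2_boundedE:
  assumes "L2_bounded M Y" and "\<And>n. n \<ge> 1 \<Longrightarrow> Y n \<in> borel_measurable M"
  obtains C where "\<And>n. n \<ge> 1 \<Longrightarrow> integrable M (\<lambda>x. (Y n x)\<^sup>2)"
    and "\<And>n. n \<ge> 1 \<Longrightarrow> (\<integral>x. (Y n x)\<^sup>2 \<partial>M) \<le> C"
proof -
  define K where "K = (SUP n\<in>{1..}. \<integral>\<^sup>+ x. ennreal ((Y n x)\<^sup>2) \<partial>M)"
  have "K < \<infinity>"
    using \<open>L2_bounded M Y\<close> by (simp add: L2_bounded_def K_def)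
  have le: "(\<integral>\<^sup>+ x. ennreal ((Y n x)\<^sup>2) \<partial>M) \<le> K" if "n \<ge> 1" for n
    unfolding K_def using that by (intro SUP_upper) auto
  have int: "integrable M (\<lambda>x. (Y n x)\<^sup>2)" if "n \<ge> 1" for n
    using le_less_trans[OF le[OF that] \<open>K < \<infinity>\<close>] assms(2)[OF that]
    by (intro integrableI_bounded) auto
  moreover have "(\<integral>x. (Y n x)\<^sup>2 \<partial>M) \<le> enn2real K" if "n \<ge> 1" for n
    using le[OF that] \<open>K < \<infinity>\<close> int[OF that]
    by (subst integral_eq_nn_integral) (auto intro!: enn2real_mono)
  ultimately show ?thesis
    using that by blast
qed

lemma L2_boundedI:
  assumes C: "\<And>n. n \<ge> 1 \<Longrightarrow> integrable M (\<lambda>x. (Y n x)\<^sup>2)"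
    "\<And>n. n \<ge> 1 \<Longrightarrow> (\<integral>x. (Y n x)\<^sup>2 \<partial>M) \<le> C"
  shows "L2_bounded M Y"
proof -
  have "(SUP n\<in>{1..}. \<integral>\<^sup>+ x. ennreal ((Y n x)\<^sup>2) \<partial>M) \<le> ennreal C"
    using C by (intro SUP_least) (auto simp: nn_integral_eq_integral intro!: ennreal_leI)
  also have "\<dots> < \<infinity>"
    by simp
  finally show ?thesis
    by (simp add: L2_bounded_def)
qed

text \<open>Rests on (a + b)^2 \<le> 2 a^2 + 2 b^2. It serves both for differences from a
  conditional expectation and for passing between returns and profits.\<close>

lemma L2_bounded_dominated:
  assumes meas: "\<And>n. n \<ge> 1 \<Longrightarrow> Y n \<in> borel_measurable M" "\<And>n. n \<ge> 1 \<Longrightarrow> Z n \<in> borel_measurable M"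
      "\<And>n. n \<ge> 1 \<Longrightarrow> W n \<in> borel_measurable M"
    and dom: "\<And>n x. n \<ge> 1 \<Longrightarrow> x \<in> space M \<Longrightarrow> \<bar>W n x\<bar> \<le> \<bar>Y n x\<bar> + \<bar>Z n x\<bar>"
    and "L2_bounded M Y" "L2_bounded M Z"
  shows "L2_bounded M W"
proof -
  obtain C1 where Y: "\<And>n. n \<ge> 1 \<Longrightarrow> integrable M (\<lambda>x. (Y n x)\<^sup>2)"
      "\<And>n. n \<ge> 1 \<Longrightarrow> (\<integral>x. (Y n x)\<^sup>2 \<partial>M) \<le> C1"
    using L2_boundedE[OF \<open>L2_bounded M Y\<close> meas(1)] by blast
  obtain C2 where Z: "\<And>n. n \<ge> 1 \<Longrightarrow> integrable M (\<lambda>x. (Z n x)\<^sup>2)"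
      "\<And>n. n \<ge> 1 \<Longrightarrow> (\<integral>x. (Z n x)\<^sup>2 \<partial>M) \<le> C2"
    using L2_boundedE[OF \<open>L2_bounded M Z\<close> meas(2)] by blast
  have *: "integrable M (\<lambda>x. (W n x)\<^sup>2) \<and> (\<integral>x. (W n x)\<^sup>2 \<partial>M) \<le> 2 * C1 + 2 * C2" if n: "n \<ge> 1" for n
  proof -
    have le: "(W n x)\<^sup>2 \<le> 2 * (Y n x)\<^sup>2 + 2 * (Z n x)\<^sup>2" if "x \<in> space M" for x
    proof -
      have "(W n x)\<^sup>2 \<le> (\<bar>Y n x\<bar> + \<bar>Z n x\<bar>)\<^sup>2"
        using dom[OF n that] by (metis abs_ge_zero power2_abs power_mono)
      also have "\<dots> \<le> 2 * (Y n x)\<^sup>2 + 2 * (Z n x)\<^sup>2"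
        using sum_squares_bound[of "\<bar>Y n x\<bar>" "\<bar>Z n x\<bar>"] by (simp add: power2_sum)
      finally show ?thesis .
    qed
    have YZ: "integrable M (\<lambda>x. 2 * (Y n x)\<^sup>2 + 2 * (Z n x)\<^sup>2)"
      using Y Z n by simp
    have W: "integrable M (\<lambda>x. (W n x)\<^sup>2)"
      using meas n le by (intro Bochner_Integration.integrable_bound[OF YZ]) (auto intro!: AE_I2)
    have "(\<integral>x. (W n x)\<^sup>2 \<partial>M) \<le> (\<integral>x. 2 * (Y n x)\<^sup>2 + 2 * (Z n x)\<^sup>2 \<partial>M)"
      using W YZ le by (intro integral_mono) auto
    also have "\<dots> \<le> 2 * C1 + 2 * C2"
      using Y[OF n] Z[OF n] by simp
    finally show ?thesis
      using W by blast
  qed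
  show ?thesis
    by (rule L2_boundedI) (use * in auto)
qed

lemma (in finite_measure) L2_bounded_integrable:
  assumes "L2_bounded M Y" and meas: "\<And>n. n \<ge> 1 \<Longrightarrow> Y n \<in> borel_measurable M" and "n \<ge> 1"
  shows "integrable M (Y n)"
proof -
  have "integrable M (\<lambda>x. (Y n x)\<^sup>2)"
    using L2_boundedE[OF assms(1) meas] \<open>n \<ge> 1\<close> by blast
  with meas[OF \<open>n \<ge> 1\<close>] show ?thesis
    by (rule square_integrable_imp_integrable)
qed

section \<open>Conditional expectations in L2 and the strong law for compensated sums\<close>

text \<open>Conditional Jensen for the square function makes conditional expectation a contraction
  of L2.\<close>

lemma (in sigma_finite_subalgebra) real_cond_exp_power2:
  assumes "integrable M f" "integrable M (\<lambda>x. (f x)\<^sup>2)"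
  shows "integrable M (\<lambda>x. (real_cond_exp M F f x)\<^sup>2)"
    and "(\<integral>x. (real_cond_exp M F f x)\<^sup>2 \<partial>M) \<le> (\<integral>x. (f x)\<^sup>2 \<partial>M)"
proof -
  show int: "integrable M (\<lambda>x. (real_cond_exp M F f x)\<^sup>2)"
    using assms convex_power2 by (intro integrable_convex_cond_exp[where I = UNIV]) auto
  have "(\<integral>x. (real_cond_exp M F f x)\<^sup>2 \<partial>M) \<le> (\<integral>x. real_cond_exp M F (\<lambda>x. (f x)\<^sup>2) x \<partial>M)"
    using assms int convex_power2
    by (intro integral_mono_AE real_cond_exp_jensens_inequality(2)[where I = UNIV] real_cond_exp_int) auto
  also have "\<dots> = (\<integral>x. (f x)\<^sup>2 \<partial>M)"
    using assms by (intro real_cond_exp_int)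
  finally show "(\<integral>x. (real_cond_exp M F f x)\<^sup>2 \<partial>M) \<le> (\<integral>x. (f x)\<^sup>2 \<partial>M)" .
qed

text \<open>Conditional expectation is an orthogonal projection: an \<open>F\<close>-measurable
  factor may be moved through it, so \<open>f * g\<close> and \<open>f * real_cond_exp M F g\<close>
  have equal integrals.\<close>

lemma (in sigma_finite_subalgebra) real_cond_exp_residual_orthogonal:
  assumes [measurable]: "f \<in> borel_measurable F" "g \<in> borel_measurable M"
    and f: "integrable M (\<lambda>x. (f x)\<^sup>2)" and g: "integrable M (\<lambda>x. (g x)\<^sup>2)"
  shows "(\<integral>x. f x * (g x - real_cond_exp M F g x) \<partial>M) = 0"
proof -
  have [measurable]: "f \<in> borel_measurable M"
    by (rule measurable_from_subalg[OF subalg]) fact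
  have fg: "integrable M (\<lambda>x. f x * g x)"
    using f g by (intro integrable_mult_of_squares) auto
  show ?thesis
    using real_cond_exp_intg[OF fg] fg by (simp add: right_diff_distrib)
qed

text \<open>The compensated terms are martingale differences. They are bounded in L2 because
  conditional expectation contracts second moments, and they are pairwise orthogonal, so the
  orthogonal strong law applies.\<close>

lemma pred_exp_strong_law:
  assumes "finite_measure M" and filt: "filtration (space M) F" and sub: "\<And>n. subalgebra M (F n)"
    and ad: "adapted_seq F Y" and L2: "L2_bounded M Y"
  shows "AE x in M. (\<lambda>n. (\<Sum>k=1..n. Y k x - pred_exp M F Y k x) / real n) \<longlonglongrightarrow> 0"
proof -
  interpret finite_measure M by fact
  interpret filtration "space M" F by fact
  have sfs: "sigma_finite_subalgebra M (F n)" for n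
    using sub by (intro finite_measure_subalgebra_is_sigma_finite)
      (simp add: finite_measure_subalgebra_def finite_measure_subalgebra_axioms_def finite_measure_axioms)
  have subF: "subalgebra (F n) (F m)" if "m \<le> n" for m n
    using sets_F_mono[OF that] by (simp add: subalgebra_def space_F)
  have YF: "Y k \<in> borel_measurable (F k)" if "k \<ge> 1" for k
    using ad that by (simp add: adapted_seq_def)
  have Ymeas[measurable]: "Y k \<in> borel_measurable M" if "k \<ge> 1" for k
    using measurable_from_subalg[OF sub YF[OF that]] .
  obtain C where Y: "\<And>n. n \<ge> 1 \<Longrightarrow> integrable M (\<lambda>x. (Y n x)\<^sup>2)"
      and C: "\<And>n. n \<ge> 1 \<Longrightarrow> (\<integral>x. (Y n x)\<^sup>2 \<partial>M) \<le> C"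
    using L2_boundedE[OF L2 Ymeas] by blast
  define P where "P = pred_exp M F Y"
  have PF: "P k \<in> borel_measurable (F (k - 1))" for k
    by (simp add: P_def pred_exp_def[abs_def])
  have Pmeas: "P k \<in> borel_measurable M" for k
    by (simp add: P_def pred_exp_def[abs_def])
  have P: "integrable M (\<lambda>x. (P k x)\<^sup>2)" "(\<integral>x. (P k x)\<^sup>2 \<partial>M) \<le> C" if "k \<ge> 1" for k
  proof -
    interpret sigma_finite_subalgebra M "F (k - 1)" by (rule sfs)
    have "integrable M (Y k)"
      using L2_bounded_integrable[OF L2 Ymeas that] .
    then show "integrable M (\<lambda>x. (P k x)\<^sup>2)" "(\<integral>x. (P k x)\<^sup>2 \<partial>M) \<le> C"
      using real_cond_exp_power2[of "Y k"] Y[OF that] C[OF that] by (auto simp: P_def pred_exp_def)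
  qed
  define D where "D k x = Y k x - P k x" for k x
  have DF: "D k \<in> borel_measurable (F k)" if "k \<ge> 1" for k
    unfolding D_def[abs_def]
    using YF[OF that] measurable_from_subalg[OF subF PF, of k k] by simp
  have D2: "L2_bounded M D"
  proof (rule L2_bounded_dominated[where Y = Y and Z = P])
    show "L2_bounded M P"
      by (rule L2_boundedI[of _ _ C]) (use P in auto)
    show "\<And>n x. n \<ge> 1 \<Longrightarrow> x \<in> space M \<Longrightarrow> \<bar>D n x\<bar> \<le> \<bar>Y n x\<bar> + \<bar>P n x\<bar>"
      by (simp add: D_def)
    show "\<And>n. n \<ge> 1 \<Longrightarrow> D n \<in> borel_measurable M"
      using measurable_from_subalg[OF sub DF] .
  qed (use L2 Ymeas Pmeas in auto)
  have Dmeas: "D k \<in> borel_measurable M" if "k \<ge> 1" for k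
    using measurable_from_subalg[OF sub DF[OF that]] .
  obtain C' where C': "\<And>n. n \<ge> 1 \<Longrightarrow> integrable M (\<lambda>x. (D n x)\<^sup>2)"
      "\<And>n. n \<ge> 1 \<Longrightarrow> (\<integral>x. (D n x)\<^sup>2 \<partial>M) \<le> C'"
    using L2_boundedE[OF D2 Dmeas] by blast
  \<comment> \<open>From j < k follows j \<le> k - 1, so \<open>D j\<close> is already known when
    \<open>Y k\<close> is predicted, and \<open>D k\<close> is the residual of that
    prediction.\<close>
  have "(\<integral>x. D j x * D k x \<partial>M) = 0" if "1 \<le> j" "j < k" for j k
  proof -
    have "D j \<in> borel_measurable (F (k - 1))"
      using that by (intro measurable_from_subalg[OF subF DF]) auto
    then show ?thesis
      using sigma_finite_subalgebra.real_cond_exp_residual_orthogonal[OF sfs, of "D j" "k - 1" "Y k"]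
        that Y[of k] C'(1)[of j] Ymeas[of k]
      by (simp add: D_def P_def pred_exp_def)
  qed
  then have "AE x in M. (\<lambda>n. (\<Sum>k=1..n. D k x) / real n) \<longlonglongrightarrow> 0"
    using Dmeas C' by (intro orthogonal_strong_law) auto
  then show ?thesis
    by (simp add: D_def P_def)
qed

section \<open>Deterministic perturbation of ratios\<close>

text \<open>The extended-real limit laws ask only that the factor have a positive finite limit and
  the added term a finite one, so \<open>r\<close> may have infinite lower or upper limit.\<close>

lemma liminf_limsup_affine_perturb:
  fixes r a c :: "nat \<Rightarrow> real"
  assumes "a \<longlonglongrightarrow> 0" "c \<longlonglongrightarrow> 1"
  shows "liminf (\<lambda>n. ereal (c n * (a n + r n))) = liminf (\<lambda>n. ereal (r n))"
    and "limsup (\<lambda>n. ereal (c n * (a n + r n))) = limsup (\<lambda>n. ereal (r n))"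
proof -
  have a: "(\<lambda>n. ereal (a n)) \<longlonglongrightarrow> 0" and c: "(\<lambda>n. ereal (c n)) \<longlonglongrightarrow> 1"
    using assms by (simp_all add: zero_ereal_def one_ereal_def)
  have "liminf (\<lambda>n. ereal (c n) * (ereal (a n) + ereal (r n))) = liminf (\<lambda>n. ereal (r n))"
    using ereal_liminf_lim_mult[OF c, of "\<lambda>n. ereal (a n) + ereal (r n)"]
      ereal_liminf_lim_add[OF a, of "\<lambda>n. ereal (r n)"] by simp
  then show "liminf (\<lambda>n. ereal (c n * (a n + r n))) = liminf (\<lambda>n. ereal (r n))"
    by simp
  have "limsup (\<lambda>n. ereal (c n) * (ereal (a n) + ereal (r n))) = limsup (\<lambda>n. ereal (r n))"
    using ereal_limsup_lim_mult[OF c, of "\<lambda>n. ereal (a n) + ereal (r n)"]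
      ereal_limsup_lim_add[OF a, of "\<lambda>n. ereal (r n)"] by simp
  then show "limsup (\<lambda>n. ereal (c n * (a n + r n))) = limsup (\<lambda>n. ereal (r n))"
    by simp
qed

text \<open>Any real number strictly between 0 and the lower limit serves as
  \<open>\<delta>\<close>; such a number exists even if the lower limit is infinite.\<close>

lemma liminf_avg_pos_imp_ge:
  fixes s :: "nat \<Rightarrow> real"
  assumes "liminf (\<lambda>n. ereal (1 / real n * s n)) > 0"
  obtains \<delta> where "\<delta> > 0" "\<forall>\<^sub>F n in sequentially. s n > \<delta> * real n"
proof -
  obtain z where z: "0 < ereal z" "ereal z < liminf (\<lambda>n. ereal (1 / real n * s n))"
    using ereal_dense2[OF assms] by auto
  have "\<forall>\<^sub>F n in sequentially. s n > z * real n"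
    using less_LiminfD[OF z(2)] eventually_gt_at_top[of 0]
    by eventually_elim (simp add: field_simps)
  then show ?thesis
    using z that by auto
qed

text \<open>Here \<open>s\<close>, \<open>t\<close> stand for the actual sums and \<open>p\<close>,
  \<open>q\<close> for the predictable ones. The identity p/q = (t/q) (s/t - (s - p)/t) reduces the
  claim to t/q tending to 1 and (s - p)/t tending to 0.\<close>

lemma ratio_perturb_liminf_limsup:
  fixes s t p q :: "nat \<Rightarrow> real"
  assumes "\<delta> > 0" and t: "\<forall>\<^sub>F n in sequentially. t n > \<delta> * real n"
    and sp: "(\<lambda>n. (s n - p n) / real n) \<longlonglongrightarrow> 0"
    and tq: "(\<lambda>n. (t n - q n) / real n) \<longlonglongrightarrow> 0"
  shows "\<forall>\<^sub>F n in sequentially. t n > 0 \<and> q n > 0"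
    and "liminf (\<lambda>n. ereal (p n / q n)) = liminf (\<lambda>n. ereal (s n / t n))"
    and "limsup (\<lambda>n. ereal (p n / q n)) = limsup (\<lambda>n. ereal (s n / t n))"
proof -
  have pos: "\<forall>\<^sub>F n in sequentially. t n > 0"
    using t eventually_gt_at_top[of 0]
  proof eventually_elim
    case (elim n)
    then have "0 < \<delta> * real n"
      using \<open>\<delta> > 0\<close> by simp
    with elim show ?case
      by linarith
  qed
  \<comment> \<open>Since \<open>t\<close> grows at least linearly, dividing by \<open>t n\<close>
    instead of n costs at most the factor 1/\<delta>.\<close>
  have small: "(\<lambda>n. (v n - w n) / t n) \<longlonglongrightarrow> 0"
    if lim: "(\<lambda>n. (v n - w n) / real n) \<longlonglongrightarrow> 0" for v w :: "nat \<Rightarrow> real"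
  proof (rule Lim_null_comparison)
    show "(\<lambda>n. \<bar>(v n - w n) / real n\<bar> / \<delta>) \<longlonglongrightarrow> 0"
      using tendsto_divide_zero[OF tendsto_rabs_zero[OF lim]] .
    show "\<forall>\<^sub>F n in sequentially. norm ((v n - w n) / t n) \<le> \<bar>(v n - w n) / real n\<bar> / \<delta>"
      using t pos eventually_gt_at_top[of 0]
    proof eventually_elim
      case (elim n)
      then have "\<bar>v n - w n\<bar> / t n \<le> \<bar>v n - w n\<bar> / (\<delta> * real n)"
        using elim \<open>\<delta> > 0\<close> by (intro divide_left_mono mult_pos_pos) auto
      then show ?case
        using elim \<open>\<delta> > 0\<close> by (simp add: abs_divide mult.commute)
    qed
  qed
  have "(\<lambda>n. 1 - (t n - q n) / t n) \<longlonglongrightarrow> 1"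
    using tendsto_diff[OF tendsto_const small[OF tq], of 1] by simp
  moreover have "\<forall>\<^sub>F n in sequentially. 1 - (t n - q n) / t n = q n / t n"
    using pos by eventually_elim (simp add: diff_divide_distrib)
  ultimately have qt: "(\<lambda>n. q n / t n) \<longlonglongrightarrow> 1"
    by (rule Lim_transform_eventually)
  \<comment> \<open>Positivity of \<open>q\<close> is not assumed; it is inherited from
    \<open>t\<close> because the quotient tends to 1.\<close>
  have "\<forall>\<^sub>F n in sequentially. q n / t n > 0"
    using order_tendstoD(1)[OF qt, of 0] by simp
  with pos show tqpos: "\<forall>\<^sub>F n in sequentially. t n > 0 \<and> q n > 0"
    by eventually_elim (simp add: zero_less_divide_iff)
  have c: "(\<lambda>n. inverse (q n / t n)) \<longlonglongrightarrow> 1"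
    using tendsto_inverse[OF qt] by simp
  have a: "(\<lambda>n. - ((s n - p n) / t n)) \<longlonglongrightarrow> 0"
    using tendsto_minus[OF small[OF sp]] by simp
  have eq: "\<forall>\<^sub>F n in sequentially.
      ereal (p n / q n) = ereal (inverse (q n / t n) * (- ((s n - p n) / t n) + s n / t n))"
    using tqpos by eventually_elim (simp add: field_simps)
  show "liminf (\<lambda>n. ereal (p n / q n)) = liminf (\<lambda>n. ereal (s n / t n))"
    using Liminf_eq[OF eq] liminf_limsup_affine_perturb(1)[OF a c] by simp
  show "limsup (\<lambda>n. ereal (p n / q n)) = limsup (\<lambda>n. ereal (s n / t n))"
    using Limsup_eq[OF eq] liminf_limsup_affine_perturb(2)[OF a c] by simp
qed

text \<open>For q \<noteq> 0 the quotient drops by exactly 1; for q = 0 the numerator is unchanged,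
  so the 0/0 convention is respected.\<close>

lemma ratio_between_shift:
  "ratio_between (l - 1) (p - q) q (u - 1) \<longleftrightarrow> ratio_between l p q u"
  unfolding ratio_between_def by (auto simp: diff_divide_distrib)

text \<open>The form without denominators also covers 0/0, where all sides are 0, and unlike the
  ratios it can be summed over the coups.\<close>

lemma ratio_between_imp_le:
  assumes "ratio_between l p q u" "q \<ge> 0"
  shows "l * q \<le> p" "p \<le> u * q"
  using assms unfolding ratio_between_def by (auto simp: field_simps)

lemma liminf_limsup_between:
  fixes f :: "nat \<Rightarrow> real"
  assumes "\<forall>\<^sub>F n in sequentially. l \<le> f n \<and> f n \<le> u"
  shows "ereal l \<le> liminf (\<lambda>n. ereal (f n))" "limsup (\<lambda>n. ereal (f n)) \<le> ereal u"
proof -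
  show "ereal l \<le> liminf (\<lambda>n. ereal (f n))"
    using assms by (intro Liminf_bounded) (auto elim: eventually_mono)
  show "limsup (\<lambda>n. ereal (f n)) \<le> ereal u"
    using assms by (intro Limsup_bounded) (auto elim: eventually_mono)
qed

section \<open>Limits of the return and profit ratios\<close>

theorem theorem3p1:
  fixes M :: "'a measure" and F :: "nat \<Rightarrow> 'a measure"
    and B R X :: "nat \<Rightarrow> 'a \<Rightarrow> real"
  assumes "prob_space M"
    and "filtration (space M) F" and "\<And>n. subalgebra M (F n)"
    and "\<And>n. n \<ge> 1 \<Longrightarrow> wager M (B n) (R n) (X n)"
    and "adapted_seq F B" and "adapted_seq F R" and "adapted_seq F X"
    and "L2_bounded M B"
    and "AE \<omega> in M. liminf (\<lambda>n. ereal (1 / real n * (\<Sum>k=1..n. B k \<omega>))) > 0"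
  shows
    "(L2_bounded M R \<longleftrightarrow> L2_bounded M X) \<and>
     (L2_bounded M R \<longrightarrow>
       (AE \<omega> in M. \<forall>\<^sub>F n in sequentially.
          (\<Sum>k=1..n. B k \<omega>) > 0 \<and> (\<Sum>k=1..n. pred_exp M F B k \<omega>) > 0) \<and>
       (\<forall>Y\<in>{R, X}. AE \<omega> in M.
          liminf (\<lambda>n. ereal (sum_ratio (pred_exp M F Y) (pred_exp M F B) n \<omega>))
            = liminf (\<lambda>n. ereal (sum_ratio Y B n \<omega>)) \<and>
          liminf (\<lambda>n. ereal (sum_ratio Y B n \<omega>))
            \<le> limsup (\<lambda>n. ereal (sum_ratio Y B n \<omega>)) \<and>
          limsup (\<lambda>n. ereal (sum_ratio Y B n \<omega>))
            = limsup (\<lambda>n. ereal (sum_ratio (pred_exp M F Y) (pred_exp M F B) n \<omega>))) \<and>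
       (\<forall>\<rho>' \<rho>'' c' c''. c' = \<rho>' - 1 \<and> c'' = \<rho>'' - 1 \<longrightarrow>
          (cond_ratio_between M F R B \<rho>' \<rho>'' \<longleftrightarrow> cond_ratio_between M F X B c' c'') \<and>
          (cond_ratio_between M F R B \<rho>' \<rho>'' \<longrightarrow>
            (AE \<omega> in M.
               ereal \<rho>' \<le> liminf (\<lambda>n. ereal (sum_ratio R B n \<omega>)) \<and>
               liminf (\<lambda>n. ereal (sum_ratio R B n \<omega>))
                 \<le> limsup (\<lambda>n. ereal (sum_ratio R B n \<omega>)) \<and>
               limsup (\<lambda>n. ereal (sum_ratio R B n \<omega>)) \<le> ereal \<rho>'') \<and>
            (AE \<omega> in M.
               ereal c' \<le> liminf (\<lambda>n. ereal (sum_ratio X B n \<omega>)) \<and>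
               liminf (\<lambda>n. ereal (sum_ratio X B n \<omega>))
                 \<le> limsup (\<lambda>n. ereal (sum_ratio X B n \<omega>)) \<and>
               limsup (\<lambda>n. ereal (sum_ratio X B n \<omega>)) \<le> ereal c''))) \<and>
       (\<forall>\<rho> c. c = \<rho> - 1 \<and> cond_ratio_between M F R B \<rho> \<rho> \<longrightarrow>
          (AE \<omega> in M. (\<lambda>n. sum_ratio R B n \<omega>) \<longlonglongrightarrow> \<rho>) \<and>
          (AE \<omega> in M. (\<lambda>n. sum_ratio X B n \<omega>) \<longlonglongrightarrow> c)))"
proof -
  interpret prob_space M by fact
  have sfs: "sigma_finite_subalgebra M (F n)" for n
    using assms(3) by (intro finite_measure_subalgebra_is_sigma_finite)
      (simp add: finite_measure_subalgebra_def finite_measure_subalgebra_axioms_def finite_measure_axioms)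
  note w = assms(4)[unfolded wager_def]
  have meas: "B n \<in> borel_measurable M" "R n \<in> borel_measurable M" "X n \<in> borel_measurable M"
    if "n \<ge> 1" for n
    using w[OF that] by auto
  have X_eq: "X n \<omega> = R n \<omega> - B n \<omega>" and nonneg: "B n \<omega> \<ge> 0" "R n \<omega> \<ge> 0"
    if "n \<ge> 1" "\<omega> \<in> space M" for n \<omega>
    using w[OF that(1)] that(2) by auto
  \<comment> \<open>From X = R - B with nonnegative R and B follow |X| \<le> |R| + |B| and |R| \<le>
    |X| + |B|.\<close>
  have equiv: "L2_bounded M R \<longleftrightarrow> L2_bounded M X"
  proof
    assume "L2_bounded M R"
    then show "L2_bounded M X"
      using meas X_eq nonneg \<open>L2_bounded M B\<close>
      by (intro L2_bounded_dominated[of R M B X]) (auto simp: abs_le_iff)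
  next
    assume "L2_bounded M X"
    then show "L2_bounded M R"
      using meas X_eq nonneg \<open>L2_bounded M B\<close>
      by (intro L2_bounded_dominated[of X M B R]) (auto simp: abs_le_iff)
  qed
  define P where "P Y = pred_exp M F Y" for Y
  have slln: "AE \<omega> in M. (\<lambda>n. ((\<Sum>k=1..n. Y k \<omega>) - (\<Sum>k=1..n. P Y k \<omega>)) / real n) \<longlonglongrightarrow> 0"
    if "adapted_seq F Y" "L2_bounded M Y" for Y
    using pred_exp_strong_law[OF finite_measure_axioms assms(2,3) that]
    by (simp add: sum_subtractf P_def)
  \<comment> \<open>The deterministic perturbation result is applied path by path, on the event
    where both strong laws and the growth of the bets hold. The instance \<open>Y = B\<close> later
    supplies the positivity of the denominators.\<close>
  have ratio: "AE \<omega> in M.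
      (\<forall>\<^sub>F n in sequentially. (\<Sum>k=1..n. B k \<omega>) > 0 \<and> (\<Sum>k=1..n. P B k \<omega>) > 0) \<and>
      liminf (\<lambda>n. ereal (sum_ratio (P Y) (P B) n \<omega>)) = liminf (\<lambda>n. ereal (sum_ratio Y B n \<omega>)) \<and>
      limsup (\<lambda>n. ereal (sum_ratio (P Y) (P B) n \<omega>)) = limsup (\<lambda>n. ereal (sum_ratio Y B n \<omega>))"
    if "adapted_seq F Y" "L2_bounded M Y" for Y
    using slln[OF that] slln[OF assms(5) \<open>L2_bounded M B\<close>] assms(9)
  proof eventually_elim
    case (elim \<omega>)
    obtain \<delta> where "\<delta> > 0" "\<forall>\<^sub>F n in sequentially. (\<Sum>k=1..n. B k \<omega>) > \<delta> * real n"
      using liminf_avg_pos_imp_ge[OF elim(3)] .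
    from ratio_perturb_liminf_limsup[OF this elim(1,2)] show ?case
      by (simp add: sum_ratio_def)
  qed
  have le: "liminf (\<lambda>n. ereal (f n)) \<le> limsup (\<lambda>n. ereal (f n))" for f :: "nat \<Rightarrow> real"
    by (simp add: Liminf_le_Limsup)
  have between: "AE \<omega> in M.
      ereal l \<le> liminf (\<lambda>n. ereal (sum_ratio Y B n \<omega>)) \<and>
      liminf (\<lambda>n. ereal (sum_ratio Y B n \<omega>)) \<le> limsup (\<lambda>n. ereal (sum_ratio Y B n \<omega>)) \<and>
      limsup (\<lambda>n. ereal (sum_ratio Y B n \<omega>)) \<le> ereal u"
    if Y: "adapted_seq F Y" "L2_bounded M Y" and cr: "cond_ratio_between M F Y B l u" for Y l u
  proof -
    have "AE \<omega> in M. ratio_between l (P Y n \<omega>) (P B n \<omega>) u \<and> P B n \<omega> \<ge> 0" if n: "n \<ge> 1" for n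
    proof -
      have "AE \<omega> in M. P B n \<omega> \<ge> 0"
        unfolding P_def pred_exp_def
        using w[OF n] by (intro sigma_finite_subalgebra.real_cond_exp_pos[OF sfs]) auto
      moreover have "AE \<omega> in M. ratio_between l (P Y n \<omega>) (P B n \<omega>) u"
        using cr n by (simp add: cond_ratio_between_def P_def)
      ultimately show ?thesis
        by eventually_elim simp
    qed
    \<comment> \<open>Countably many exceptional null sets are merged into one, so that the bounds
      for all coups can be added along a single path.\<close>
    then have "AE \<omega> in M. \<forall>n\<in>{1..}. ratio_between l (P Y n \<omega>) (P B n \<omega>) u \<and> P B n \<omega> \<ge> 0"
      by (subst AE_ball_countable) auto
    then show ?thesis
      using ratio[OF Y]
    proof eventually_elim
      case (elim \<omega>)
      have "\<forall>\<^sub>F n in sequentially. l \<le> sum_ratio (P Y) (P B) n \<omega> \<and> sum_ratio (P Y) (P B) n \<omega> \<le> u"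
        using elim(2)[THEN conjunct1]
      proof eventually_elim
        case (elim n)
        have bounds: "l * P B k \<omega> \<le> P Y k \<omega>" "P Y k \<omega> \<le> u * P B k \<omega>" if "k \<in> {1..n}" for k
          using ratio_between_imp_le[of l "P Y k \<omega>" "P B k \<omega>" u] that
            \<open>\<forall>n\<in>{1..}. ratio_between l (P Y n \<omega>) (P B n \<omega>) u \<and> P B n \<omega> \<ge> 0\<close> by auto
        have "l * (\<Sum>k=1..n. P B k \<omega>) \<le> (\<Sum>k=1..n. P Y k \<omega>)"
          "(\<Sum>k=1..n. P Y k \<omega>) \<le> u * (\<Sum>k=1..n. P B k \<omega>)"
          using bounds by (auto simp: sum_distrib_left intro!: sum_mono)
        then show ?case
          using elim by (simp add: sum_ratio_def pos_le_divide_eq pos_divide_le_eq)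
      qed
      \<comment> \<open>The bounds hold for the predictable ratio; equality of the lower and upper
        limits carries them over to the actual ratio.\<close>
      then show ?case
        using liminf_limsup_between[of l "\<lambda>n. sum_ratio (P Y) (P B) n \<omega>" u] elim(2) le
        by metis
    qed
  qed
  have main: ?thesis if "L2_bounded M R"
  proof -
    have "L2_bounded M X"
      using equiv that by simp
    have L2: "adapted_seq F Y \<and> L2_bounded M Y" if "Y \<in> {R, X}" for Y
      using that \<open>L2_bounded M R\<close> \<open>L2_bounded M X\<close> assms(6,7) by auto
    have pos: "AE \<omega> in M. \<forall>\<^sub>F n in sequentially.
        (\<Sum>k=1..n. B k \<omega>) > 0 \<and> (\<Sum>k=1..n. pred_exp M F B k \<omega>) > 0"
      using ratio[OF assms(5) \<open>L2_bounded M B\<close>] by eventually_elim (simp add: P_def)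
    have a: "AE \<omega> in M.
          liminf (\<lambda>n. ereal (sum_ratio (pred_exp M F Y) (pred_exp M F B) n \<omega>))
            = liminf (\<lambda>n. ereal (sum_ratio Y B n \<omega>)) \<and>
          liminf (\<lambda>n. ereal (sum_ratio Y B n \<omega>))
            \<le> limsup (\<lambda>n. ereal (sum_ratio Y B n \<omega>)) \<and>
          limsup (\<lambda>n. ereal (sum_ratio Y B n \<omega>))
            = limsup (\<lambda>n. ereal (sum_ratio (pred_exp M F Y) (pred_exp M F B) n \<omega>))"
      if "Y \<in> {R, X}" for Y
      using ratio[of Y] L2[OF that] le by (auto simp: P_def elim: AE_mp)
    \<comment> \<open>By linearity the predicted profit is almost surely the predicted return minus
      the predicted bet. L2-boundedness provides the integrability that linearity requires.\<close>
    have shift: "cond_ratio_between M F X B (l - 1) (u - 1) \<longleftrightarrow> cond_ratio_between M F R B l u" for l u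
    proof -
      have "(AE \<omega> in M. ratio_between (l - 1) (P X n \<omega>) (P B n \<omega>) (u - 1)) \<longleftrightarrow>
          (AE \<omega> in M. ratio_between l (P R n \<omega>) (P B n \<omega>) u)" if n: "n \<ge> 1" for n
      proof -
        interpret sigma_finite_subalgebra M "F (n - 1)" by (rule sfs)
        have "AE \<omega> in M. real_cond_exp M (F (n - 1)) (\<lambda>\<omega>. R n \<omega> - B n \<omega>) \<omega> = P R n \<omega> - P B n \<omega>"
          unfolding P_def pred_exp_def
          using meas n \<open>L2_bounded M R\<close> \<open>L2_bounded M B\<close>
          by (intro real_cond_exp_diff L2_bounded_integrable)
        moreover have "AE \<omega> in M. P X n \<omega> = real_cond_exp M (F (n - 1)) (\<lambda>\<omega>. R n \<omega> - B n \<omega>) \<omega>"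
          unfolding P_def pred_exp_def using w[OF n] by (intro real_cond_exp_cong) auto
        ultimately have "AE \<omega> in M. P X n \<omega> = P R n \<omega> - P B n \<omega>"
          by eventually_elim simp
        then have "AE \<omega> in M. ratio_between (l - 1) (P X n \<omega>) (P B n \<omega>) (u - 1)
            \<longleftrightarrow> ratio_between l (P R n \<omega>) (P B n \<omega>) u"
          by eventually_elim (simp add: ratio_between_shift)
        then show ?thesis
          by (rule eventually_subst)
      qed
      then show ?thesis
        by (auto simp: cond_ratio_between_def P_def)
    qed
    \<comment> \<open>Coinciding bounds squeeze the lower and upper limits onto the same finite
      value.\<close>
    have lim: "AE \<omega> in M. (\<lambda>n. sum_ratio Y B n \<omega>) \<longlonglongrightarrow> l"
      if "Y \<in> {R, X}" "cond_ratio_between M F Y B l l" for Y l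
    proof -
      have "AE \<omega> in M. ereal l \<le> liminf (\<lambda>n. ereal (sum_ratio Y B n \<omega>)) \<and>
          limsup (\<lambda>n. ereal (sum_ratio Y B n \<omega>)) \<le> ereal l"
        using between[OF _ _ that(2)] L2[OF that(1)] by (auto elim: AE_mp)
      then show ?thesis
        by eventually_elim (simp add: limsup_le_liminf_real)
    qed
    show ?thesis
    proof (intro conjI impI ballI allI equiv pos a; (elim conjE)?)
      fix l u l' u' :: real
      assume "l' = l - 1" "u' = u - 1"
      then show iff: "cond_ratio_between M F R B l u \<longleftrightarrow> cond_ratio_between M F X B l' u'"
        by (simp add: shift)
      assume R: "cond_ratio_between M F R B l u"
      show "AE \<omega> in M. ereal l \<le> liminf (\<lambda>n. ereal (sum_ratio R B n \<omega>)) \<and>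
          liminf (\<lambda>n. ereal (sum_ratio R B n \<omega>)) \<le> limsup (\<lambda>n. ereal (sum_ratio R B n \<omega>)) \<and>
          limsup (\<lambda>n. ereal (sum_ratio R B n \<omega>)) \<le> ereal u"
        using L2[of R] R by (intro between) auto
      show "AE \<omega> in M. ereal l' \<le> liminf (\<lambda>n. ereal (sum_ratio X B n \<omega>)) \<and>
          liminf (\<lambda>n. ereal (sum_ratio X B n \<omega>)) \<le> limsup (\<lambda>n. ereal (sum_ratio X B n \<omega>)) \<and>
          limsup (\<lambda>n. ereal (sum_ratio X B n \<omega>)) \<le> ereal u'"
        using L2[of X] R iff by (intro between) auto
    next
      fix l l' :: real
      assume l': "l' = l - 1" and R: "cond_ratio_between M F R B l l"
      show "AE \<omega> in M. (\<lambda>n. sum_ratio R B n \<omega>) \<longlonglongrightarrow> l"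
        by (rule lim) (use R in auto)
      show "AE \<omega> in M. (\<lambda>n. sum_ratio X B n \<omega>) \<longlonglongrightarrow> l'"
        by (rule lim) (use R l' shift in auto)
    qed
  qed
  then show ?thesis
    using equiv by blast
qed

end
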